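(* Let $k,m\geq 1$ be integers. If $m>k$, then $$\int_{0}^{\infty}\frac{\sinh(2kx)}{x\cosh^{2m}x}\,dx=\sum_{p=1}^{m-1}\left(2^{2p+1}-1\right)\frac{\zeta(2p+1)}{\pi^{2p}}\,[z^{2m-1}]\,U_{2k-1}(z)(\arcsin z)^{2p}.$$ If $m\geq k$, then $$\int_{0}^{\infty}\frac{\sinh(2kx)}{x\cosh^{2m+1}x}\,dx=\sum_{p=1}^{m}2^{2p}\,\frac{\beta(2p)}{\pi^{2p-1}}\,[z^{2m}]\,U_{2k-1}(z)(\arcsin z)^{2p-1}.$$
   Context: $U_m$ is the Chebyshev polynomial of the second kind, normalized by $U_m(\cos\theta)=\frac{\sin((m+1)\theta)}{\sin\theta}$. $\zeta$ is the Riemann zeta function and $\beta$ is the Dirichlet beta function, $\beta(s)=\sum_{r\ge0}(-1)^r(2r+1)^{-s}$. $[z^r]F(z)$ denotes the coefficient of $z^r$ in the expansion of $F$ at the origin; $\arcsin$ is the principal branch. *)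

theory Defs
  imports "HOL-Complex_Analysis.Complex_Analysis"
begin

text \<open>
  The Chebyshev polynomials of the second kind, by the usual three-term recurrence; the lemmas
  below it show that they have the normalization $U_m(\cos\theta) = \sin((m+1)\theta)/\sin\theta$.
\<close>

fun chebyshev_U :: "nat \<Rightarrow> 'a :: comm_ring_1 poly" where
  "chebyshev_U 0 = 1"
| "chebyshev_U (Suc 0) = [:0, 2:]"
| "chebyshev_U (Suc (Suc m)) = [:0, 2:] * chebyshev_U (Suc m) - chebyshev_U m"

lemma chebyshev_U_cos_mult_sin:
  fixes \<theta> :: "'a :: {real_normed_field, banach}"
  shows "poly (chebyshev_U m) (cos \<theta>) * sin \<theta> = sin (of_nat (m + 1) * \<theta>)"
proof (induction m rule: chebyshev_U.induct)
  case 1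
  show ?case by simp
next
  case 2
  show ?case using sin_add[of \<theta> \<theta>] by (simp add: algebra_simps flip: mult_2_right)
next
  case (3 m)
  let ?a = "of_nat (m + 2) * \<theta>"
  have "sin (of_nat (m + 3) * \<theta>) = sin (?a + \<theta>)"
    and "sin (of_nat (m + 1) * \<theta>) = sin (?a - \<theta>)"
    by (simp_all add: algebra_simps)
  hence "sin (of_nat (m + 3) * \<theta>) = 2 * cos \<theta> * sin ?a - sin (of_nat (m + 1) * \<theta>)"
    by (simp add: sin_add sin_diff)
  with 3 show ?case
    by (simp add: algebra_simps numeral_3_eq_3)
qed

lemma chebyshev_U_cos:
  fixes \<theta> :: "'a :: {real_normed_field, banach}"
  assumes "sin \<theta> \<noteq> 0"
  shows "poly (chebyshev_U m) (cos \<theta>) = sin (of_nat (m + 1) * \<theta>) / sin \<theta>"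
  using chebyshev_U_cos_mult_sin[of m \<theta>] assms by (simp add: field_simps)

text \<open>
  The Riemann zeta function on its half-plane of convergence: no analytic continuation is made,
  so the value is meaningful only for $\mathrm{Re}(s) > 1$.
\<close>

definition riemann_zeta :: "complex \<Rightarrow> complex" where
  "riemann_zeta s = (\<Sum>n. 1 / of_nat (n + 1) powr s)"

text \<open>The Dirichlet beta function; similarly, meaningful only for $\mathrm{Re}(s) > 0$.\<close>

definition dirichlet_beta :: "complex \<Rightarrow> complex" where
  "dirichlet_beta s = (\<Sum>r. (- 1) ^ r / of_nat (2 * r + 1) powr s)"

end

theory Submission
  imports Defs "HOL-Real_Asymp.Real_Asymp"
begin

text \<open>
  Since $\sinh(2kx) = U_{2k-1}(\cosh x) \sinh x$, everything reduces to the integrals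
  $J_N = \int_0^\infty \sinh x / (x \cosh^N x)\,dx$ for $N \geq 2$. Summing the geometric series, their
  generating function at $z = \sin\theta$ is
  \[ \sum_{n\geq 1} J_{n+1} z^n = \int_0^\infty \frac{\sinh x}{x}
       \left(\frac{1}{\cosh x - \sin\theta} - \frac{1}{\cosh x}\right) dx. \]
  With $a_j = (2j+1)\pi/2$ and $b_j = a_j - (-1)^j\theta$, the partial fraction expansion of the cotangent
  turns the integrand into $\sum_j \left(\frac{2}{x^2+b_j^2} - \frac{2}{x^2+a_j^2}\right)$, so that the
  integral is $\pi \sum_j (1/b_j - 1/a_j) = \sum_{q\geq 1} c_q \theta^q$ with
  $c_q = \pi \sum_j (-1)^{jq} a_j^{-q-1}$. These $c_q$ are the zeta and beta values of the statement, and
  $J_{n+1} = [z^n] \sum_q c_q (\arcsin z)^q$. Multiplying by $U_{2k-1}$, the parity of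
  $U_{2k-1}(z)(\arcsin z)^q$ removes every other $q$.
\<close>

subsection \<open>Partial fractions\<close>

text \<open>Differentiating the reflection formula for \<open>rGamma z * rGamma (1 - z)\<close>
  gives \<open>Digamma (1 - z) - Digamma z = pi * cot (pi * z)\<close>. In the difference of the two
  limit formulas for \<open>Digamma\<close> the logarithms cancel, which leaves the series.\<close>

lemma cot_partial_fractions:
  fixes z :: complex
  assumes "z \<notin> \<int>"
  shows "(\<lambda>n. 1 / (z + of_nat n) - 1 / (1 - z + of_nat n)) sums (of_real pi * cot (of_real pi * z))"
proof -
  have z: "z \<noteq> 0" "1 - z \<noteq> 0" "z \<notin> \<int>\<^sub>\<le>\<^sub>0" "1 - z \<notin> \<int>\<^sub>\<le>\<^sub>0"
    using assms by (auto elim!: nonpos_Ints_cases) (metis Ints_1 Ints_diff Ints_of_int diff_diff_eq2 add_diff_cancel_left')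
  have sin: "sin (of_real pi * z) \<noteq> 0"
    using assms by (auto simp: sin_eq_0)
  have "((\<lambda>z. rGamma z * rGamma (1 - z)) has_field_derivative
          rGamma z * (- (rGamma (1 - z) * Digamma (1 - z)) * (-1)) + (- rGamma z * Digamma z) * rGamma (1 - z)) (at z)"
    using z by (auto intro!: derivative_eq_intros)
  hence "((\<lambda>z. sin (of_real pi * z) / of_real pi) has_field_derivative
          (rGamma z * rGamma (1 - z)) * (Digamma (1 - z) - Digamma z)) (at z)"
    unfolding rGamma_reflection_complex[symmetric] by (simp add: algebra_simps)
  moreover have "((\<lambda>z. sin (of_real pi * z) / of_real pi) has_field_derivative
          cos (of_real pi * z)) (at z)"
    by (auto intro!: derivative_eq_intros)
  ultimately have "(rGamma z * rGamma (1 - z)) * (Digamma (1 - z) - Digamma z) = cos (of_real pi * z)"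
    by (rule DERIV_unique)
  hence reflect: "Digamma (1 - z) - Digamma z = of_real pi * cot (of_real pi * z)"
    using sin by (simp add: rGamma_reflection_complex cot_def field_simps)
  have "(\<lambda>m. (\<Sum>n<m. inverse (z + of_nat n)) - (\<Sum>n<m. inverse (1 - z + of_nat n)))
          \<longlonglongrightarrow> Digamma (1 - z) - Digamma z"
    using tendsto_diff[OF Digamma_LIMSEQ[OF z(2)] Digamma_LIMSEQ[OF z(1)]]
    by (simp add: algebra_simps)
  thus ?thesis
    by (simp add: sums_def reflect sum_subtractf inverse_eq_divide)
qed

text \<open>Multiplying numerator and denominator by \<open>sin (cnj z)\<close> makes the
  denominator real; the product-to-sum formulas then apply, with \<open>z + cnj z\<close> real and
  \<open>z - cnj z\<close> purely imaginary.\<close>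

lemma Im_cot: "Im (cot (Complex a b)) = - sinh (2 * b) / (cosh (2 * b) - cos (2 * a))"
proof -
  define z where "z = Complex a b"
  have sin_i_of_real: "sin (\<i> * of_real y) = \<i> * of_real (sinh y)"
    and cos_i_of_real: "cos (\<i> * of_real y) = of_real (cosh y)" for y
    by (simp_all add: sin_i_times cos_i_times sinh_field_def cosh_field_def exp_minus exp_of_real)
  have sum: "z + cnj z = of_real (2 * a)" and diff: "z - cnj z = \<i> * of_real (2 * b)"
    by (simp_all add: z_def complex_eq_iff)
  \<comment> \<open>At a zero of \<open>sin\<close> both sides are 0 by the convention for division
    by zero.\<close>
  have "cot z = (2 * (cos z * sin (cnj z))) / (2 * (sin z * sin (cnj z)))"
    by (cases "sin z = 0") (auto simp: cot_def simp flip: cnj_sin)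
  also have "2 * (cos z * sin (cnj z)) = sin (z + cnj z) - sin (z - cnj z)"
    by (simp add: sin_add sin_diff)
  also have "2 * (sin z * sin (cnj z)) = cos (z - cnj z) - cos (z + cnj z)"
    by (simp add: cos_add cos_diff)
  also have "sin (z + cnj z) - sin (z - cnj z) = Complex (sin (2 * a)) (- sinh (2 * b))"
    unfolding sum diff sin_of_real sin_i_of_real by (simp add: complex_eq_iff)
  also have "cos (z - cnj z) - cos (z + cnj z) = of_real (cosh (2 * b) - cos (2 * a))"
    unfolding sum diff cos_of_real cos_i_of_real by simp
  finally show ?thesis
    by (simp add: z_def Im_divide_of_real)
qed

text \<open>This is the imaginary part of the cotangent expansion at
  \<open>z = (\<phi> + \<i> * x) / (2 * pi)\<close>, divided by \<open>- pi * x\<close>.\<close>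

lemma sinh_over_cosh_minus_cos_sums:
  fixes x \<phi> :: real
  assumes "x > 0"
  shows "(\<lambda>n. 2 / ((2 * pi * n + \<phi>)\<^sup>2 + x\<^sup>2) + 2 / ((2 * pi * n + (2 * pi - \<phi>))\<^sup>2 + x\<^sup>2))
           sums (sinh x / (x * (cosh x - cos \<phi>)))"
proof -
  define z where "z = Complex (\<phi> / (2 * pi)) (x / (2 * pi))"
  have "z \<notin> \<int>"
    using assms by (auto simp: z_def elim!: Ints_cases simp: complex_eq_iff)
  from sums_Im[OF cot_partial_fractions[OF this]]
  have "(\<lambda>n. Im (1 / (z + of_nat n) - 1 / (1 - z + of_nat n))) sums (pi * Im (cot (of_real pi * z)))"
    by simp
  moreover have "of_real pi * z = Complex (\<phi> / 2) (x / 2)"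
    by (simp add: z_def complex_eq_iff)
  ultimately have "(\<lambda>n. - Im (1 / (z + of_nat n) - 1 / (1 - z + of_nat n)) / (pi * x)) sums
       (-(pi * Im (cot (Complex (\<phi> / 2) (x / 2)))) / (pi * x))"
    by (intro sums_divide sums_minus) simp
  also have "-(pi * Im (cot (Complex (\<phi> / 2) (x / 2)))) / (pi * x) = sinh x / (x * (cosh x - cos \<phi>))"
    using assms by (simp add: Im_cot)
  also have "(\<lambda>n. - Im (1 / (z + of_nat n) - 1 / (1 - z + of_nat n)) / (pi * x)) =
     (\<lambda>n. 2 / ((2 * pi * n + \<phi>)\<^sup>2 + x\<^sup>2) + 2 / ((2 * pi * n + (2 * pi - \<phi>))\<^sup>2 + x\<^sup>2))"
  proof
    fix n :: nat
    have *: "- Im (1 / Complex (u / (2 * pi)) (v / (2 * pi))) = 2 * pi * v / (u\<^sup>2 + v\<^sup>2)" for u v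
      by (simp add: Im_divide complex_eq_iff power2_eq_square field_simps)
    have "z + of_nat n = Complex ((2 * pi * n + \<phi>) / (2 * pi)) (x / (2 * pi))"
      by (simp add: z_def complex_eq_iff field_simps)
    then have 1: "- Im (1 / (z + of_nat n)) = 2 * pi * x / ((2 * pi * n + \<phi>)\<^sup>2 + x\<^sup>2)"
      by (simp only: *)
    \<comment> \<open>The imaginary part of \<open>1 - z\<close> is opposite to that of
      \<open>z\<close>, so the difference in the cotangent series turns into a sum of two positive
      terms.\<close>
    have "1 - z + of_nat n = Complex ((2 * pi * n + (2 * pi - \<phi>)) / (2 * pi)) (- x / (2 * pi))"
      by (simp add: z_def complex_eq_iff field_simps)
    then have 2: "- Im (1 / (1 - z + of_nat n)) = 2 * pi * (- x) / ((2 * pi * n + (2 * pi - \<phi>))\<^sup>2 + x\<^sup>2)"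
      by (simp only: * power2_minus)
    have "- Im (1 / (z + of_nat n) - 1 / (1 - z + of_nat n)) =
        - Im (1 / (z + of_nat n)) - (- Im (1 / (1 - z + of_nat n)))"
      by simp
    also have "\<dots> = pi * x * (2 / ((2 * pi * n + \<phi>)\<^sup>2 + x\<^sup>2) + 2 / ((2 * pi * n + (2 * pi - \<phi>))\<^sup>2 + x\<^sup>2))"
      unfolding 1 2 by (simp add: distrib_left mult_ac)
    finally show "- Im (1 / (z + of_nat n) - 1 / (1 - z + of_nat n)) / (pi * x) =
      2 / ((2 * pi * n + \<phi>)\<^sup>2 + x\<^sup>2) + 2 / ((2 * pi * n + (2 * pi - \<phi>))\<^sup>2 + x\<^sup>2)"
      using assms by simp
  qed
  finally show ?thesis .
qed

section \<open>Lorentzian integrals and geometric expansions\<close>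

lemma has_bochner_integral_inverse_sum_squares:
  fixes b :: real
  assumes "b > 0"
  shows "has_bochner_integral lborel (\<lambda>x. indicator {0<..} x *\<^sub>R (2 / (b\<^sup>2 + x\<^sup>2))) (pi / b)"
proof -
  let ?F = "\<lambda>x. 2 / b * arctan (x / b)"
  have "(\<integral>\<^sup>+x. ennreal (2 / (b\<^sup>2 + x\<^sup>2)) * indicator {0..} x \<partial>lborel) = ennreal (pi / b - ?F 0)"
  proof (rule nn_integral_FTC_atLeast)
    show "DERIV ?F x :> 2 / (b\<^sup>2 + x\<^sup>2)" for x
    proof -
      have "b\<^sup>2 + x\<^sup>2 > 0"
        using assms by (simp add: add_pos_nonneg)
      then show ?thesis
        using assms by (auto intro!: derivative_eq_intros simp: power_divide add_divide_distrib[symmetric] divide_simps)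
           (simp_all add: power2_eq_square algebra_simps)
    qed
    have "((\<lambda>x. arctan (x / b)) \<longlongrightarrow> pi / 2) at_top"
      by (rule filterlim_compose[OF tendsto_arctan_at_top])
         (use assms in \<open>simp add: divide_inverse filterlim_tendsto_pos_mult_at_top[OF _ _ filterlim_ident]
            filterlim_at_top_mult_tendsto_pos[OF tendsto_const _ filterlim_ident]\<close>)
    hence "(?F \<longlongrightarrow> 2 / b * (pi / 2)) at_top"
      by (intro tendsto_intros)
    thus "(?F \<longlongrightarrow> pi / b) at_top" by simp
  qed (use assms in auto)
  \<comment> \<open>The fundamental theorem is applied on the closed half-line, which differs from
    \<open>{0<..}\<close> by a null set.\<close>
  moreover have "(\<integral>\<^sup>+x. ennreal (2 / (b\<^sup>2 + x\<^sup>2)) * indicator {0..} x \<partial>lborel) =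
     (\<integral>\<^sup>+x. ennreal (indicator {0<..} x *\<^sub>R (2 / (b\<^sup>2 + x\<^sup>2))) \<partial>lborel)"
    by (intro nn_integral_cong_AE, use AE_lborel_singleton[of "0::real"] in eventually_elim)
       (auto split: split_indicator)
  ultimately show ?thesis
    using assms by (intro has_bochner_integral_nn_integral) auto
qed

text \<open>The geometric expansion of \<open>1 / (c - z)\<close> without its constant term. It
  serves twice: with \<open>c = cosh x\<close> under the integral and with
  \<open>c = 2 * pi * n + a\<close> for the partial fractions.\<close>

lemma geometric_sums_diff_inverse:
  fixes c z :: real
  assumes "\<bar>z\<bar> < c"
  shows "(\<lambda>q. z ^ (q + 1) / c ^ (q + 2)) sums (1 / (c - z) - 1 / c)"
proof -
  have "(\<lambda>q. z / c\<^sup>2 * (z / c) ^ q) sums (z / c\<^sup>2 * (1 / (1 - z / c)))"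
    using assms by (intro sums_mult geometric_sums) simp
  also have "z / c\<^sup>2 * (1 / (1 - z / c)) = 1 / (c - z) - 1 / c"
    using assms by (simp add: divide_simps) (auto simp: power2_eq_square algebra_simps)
  finally show ?thesis
    by (simp add: power_divide power2_eq_square mult_ac)
qed

section \<open>Inverse powers along an arithmetic progression\<close>

lemma shifted_inverse_power_le:
  fixes a :: real
  assumes "a > 0"
  shows "1 / (2 * pi * real n + a) ^ (q + 2) \<le> 1 / a ^ q * (1 / (2 * pi * real n + a)\<^sup>2)"
proof -
  have "1 / (2 * pi * real n + a) ^ q \<le> 1 / a ^ q"
    using assms by (intro divide_left_mono power_mono mult_pos_pos zero_less_power add_nonneg_pos) auto
  from mult_right_mono[OF this, of "1 / (2 * pi * real n + a)\<^sup>2"] show ?thesis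
    by (simp add: power_add power2_eq_square mult_ac)
qed

lemma summable_shifted_inverse_power:
  fixes a :: real
  assumes "a > 0"
  shows "summable (\<lambda>n. 1 / (2 * pi * real n + a) ^ (q + 2))"
proof (rule summable_comparison_test')
  have "summable (\<lambda>n. 1 / (2 * pi * real n + a)\<^sup>2)"
  proof (rule summable_comparison_test_bigo)
    show "summable (\<lambda>n. norm (inverse (real n ^ 2)))"
      using inverse_power_summable[of 2, where 'a = real] by simp
    show "(\<lambda>n. 1 / (2 * pi * real n + a)\<^sup>2) \<in> O(\<lambda>n. inverse (real n ^ 2))"
      by real_asymp
  qed
  then show "summable (\<lambda>n. 1 / a ^ q * (1 / (2 * pi * real n + a)\<^sup>2))"
    by (rule summable_mult)
  show "norm (1 / (2 * pi * real n + a) ^ (q + 2)) \<le> 1 / a ^ q * (1 / (2 * pi * real n + a)\<^sup>2)" for n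
    using shifted_inverse_power_le[OF assms, of n q] assms by simp
qed

text \<open>Up to the factor \<open>1 / (2 * pi) ^ s\<close> this is the Hurwitz zeta function at
  \<open>s\<close> with parameter \<open>a / (2 * pi)\<close>.\<close>

definition shifted_zeta :: "real \<Rightarrow> nat \<Rightarrow> real" where
  "shifted_zeta a s = (\<Sum>n. 1 / (2 * pi * real n + a) ^ s)"

text \<open>Each of the \<open>q\<close> extra factors in a denominator is at least
  \<open>a\<close>. This geometric decay in \<open>q\<close> makes the double series below
  absolutely summable for \<open>\<bar>t\<bar> < a\<close>.\<close>

lemma shifted_zeta_le:
  assumes "a > 0"
  shows "shifted_zeta a (q + 2) \<le> 1 / a ^ q * shifted_zeta a 2"
  unfolding shifted_zeta_def
proof (subst suminf_mult[symmetric])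
  show "summable (\<lambda>n. 1 / (2 * pi * real n + a)\<^sup>2)"
    using summable_shifted_inverse_power[OF assms, of 0] by (simp add: power2_eq_square)
  then show "(\<Sum>n. 1 / (2 * pi * real n + a) ^ (q + 2)) \<le> (\<Sum>n. 1 / a ^ q * (1 / (2 * pi * real n + a)\<^sup>2))"
    using summable_shifted_inverse_power[OF assms, of q] shifted_inverse_power_le[OF assms]
    by (intro suminf_le summable_mult)
qed

text \<open>Each term of the series over \<open>n\<close> is expanded geometrically in
  \<open>t\<close>, and the two summations are interchanged.\<close>

lemma shifted_zeta_generating_function:
  fixes a t :: real
  assumes "\<bar>t\<bar> < a"
  shows "(\<lambda>q. t ^ (q + 1) * shifted_zeta a (q + 2)) sums
           (\<Sum>n. 1 / (2 * pi * real n + (a - t)) - 1 / (2 * pi * real n + a))"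
proof -
  define f where "f q n = t ^ (q + 1) / (2 * pi * real n + a) ^ (q + 2)" for q n
  have a: "a > 0" using assms by simp
  have pos: "2 * pi * real n + a > 0" for n
    using a by (simp add: add_nonneg_pos)
  \<comment> \<open>The local \<open>t\<close> shadows the fixed one: the expansion is also used at
    \<open>\<bar>t\<bar>\<close>, for absolute convergence.\<close>
  have geo: "(\<lambda>q. t ^ (q + 1) / (2 * pi * real n + a) ^ (q + 2)) sums
      (1 / (2 * pi * real n + (a - t)) - 1 / (2 * pi * real n + a))"
    if "\<bar>t\<bar> < a" for n t
  proof -
    have "\<bar>t\<bar> < 2 * pi * real n + a" using that by (simp add: add_nonneg_pos add_strict_increasing2)
    from geometric_sums_diff_inverse[OF this] show ?thesis by (simp add: algebra_simps)
  qed
  have norm: "norm (f q n) = \<bar>t\<bar> ^ (q + 1) * (1 / (2 * pi * real n + a) ^ (q + 2))" for q n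
    using pos[of n] by (simp add: f_def abs_mult power_abs)
  have summable: "summable (\<lambda>n. norm (f q n))" for q
    unfolding norm by (intro summable_mult summable_shifted_inverse_power a)
  then have integrable: "integrable (count_space UNIV) (f q)" for q
    by (simp add: integrable_count_space_nat_iff)
  \<comment> \<open>The sum over \<open>n\<close> is read as an integral for the counting measure,
    so that \<open>sums_integral\<close> performs the interchange; the integrability claim turns the
    outer integral back into a series.\<close>
  have "(\<lambda>q. \<integral>n. f q n \<partial>count_space UNIV) sums (\<integral>n. (\<Sum>q. f q n) \<partial>count_space UNIV)"
       "integrable (count_space UNIV) (\<lambda>n. \<Sum>q. f q n)"
  proof -
    have 1: "AE n in count_space UNIV. summable (\<lambda>q. norm (f q n))"
      unfolding norm using geo[of "\<bar>t\<bar>"] assms by (auto simp: sums_iff)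
    have 2: "summable (\<lambda>q. \<integral>n. norm (f q n) \<partial>count_space UNIV)"
    proof (rule summable_comparison_test')
      show "summable (\<lambda>q. (\<bar>t\<bar> / a) ^ q * (\<bar>t\<bar> * shifted_zeta a 2))"
        using assms by (intro summable_mult2 summable_geometric) simp
      fix q
      have "(\<integral>n. norm (f q n) \<partial>count_space UNIV) = \<bar>t\<bar> ^ (q + 1) * shifted_zeta a (q + 2)"
        unfolding shifted_zeta_def integral_count_space_nat[OF integrable_norm[OF integrable]]
        unfolding norm by (rule suminf_mult[OF summable_shifted_inverse_power[OF a]])
      also have "\<dots> \<le> \<bar>t\<bar> ^ (q + 1) * (1 / a ^ q * shifted_zeta a 2)"
        by (intro mult_left_mono shifted_zeta_le a) simp
      finally show "norm (\<integral>n. norm (f q n) \<partial>count_space UNIV) \<le> (\<bar>t\<bar> / a) ^ q * (\<bar>t\<bar> * shifted_zeta a 2)"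
        by (simp add: power_divide mult_ac)
    qed
    show "(\<lambda>q. \<integral>n. f q n \<partial>count_space UNIV) sums (\<integral>n. (\<Sum>q. f q n) \<partial>count_space UNIV)"
      "integrable (count_space UNIV) (\<lambda>n. \<Sum>q. f q n)"
      by (rule sums_integral integrable_suminf; use integrable 1 2 in blast)+
  qed
  moreover have "(\<integral>n. f q n \<partial>count_space UNIV) = t ^ (q + 1) * shifted_zeta a (q + 2)" for q
    unfolding integral_count_space_nat[OF integrable] shifted_zeta_def
    using suminf_mult[OF summable_shifted_inverse_power[OF a, of q], of "t ^ (q + 1)"]
    by (simp add: f_def[abs_def])
  moreover have "(\<Sum>q. f q n) = 1 / (2 * pi * real n + (a - t)) - 1 / (2 * pi * real n + a)" for n
    unfolding f_def using geo[OF assms, of n] by (simp add: sums_iff)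
  ultimately show ?thesis
    by (simp add: integral_count_space_nat)
qed

text \<open>The integrals \<open>pi / (2 * pi * n + c)\<close> of the single Lorentzians form a
  divergent series. Their differences for \<open>b\<close> and \<open>a\<close> decay like the
  inverse square of \<open>n\<close>, so the paired series can be integrated termwise.\<close>

lemma has_bochner_integral_suminf_lorentzian_diff:
  fixes a b :: real
  assumes "a > 0" "b > 0"
  shows "has_bochner_integral lborel
    (\<lambda>x. indicator {0<..} x *\<^sub>R (\<Sum>n. 2 / ((2 * pi * n + b)\<^sup>2 + x\<^sup>2) - 2 / ((2 * pi * n + a)\<^sup>2 + x\<^sup>2)))
    (pi * (\<Sum>n. 1 / (2 * pi * real n + b) - 1 / (2 * pi * real n + a)))"
proof -
  define g where "g c n x = indicator {0<..} x *\<^sub>R (2 / ((2 * pi * real n + c)\<^sup>2 + x\<^sup>2))" for c n x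
  define f where "f n x = g b n x - g a n x" for n x
  have pos: "2 * pi * real n + c > 0" if "c > 0" for c n
    using that by (simp add: add_nonneg_pos)
  have g: "has_bochner_integral lborel (g c n) (pi / (2 * pi * real n + c))" if "c > 0" for c n
    unfolding g_def by (rule has_bochner_integral_inverse_sum_squares) (rule pos[OF that])
  have f: "has_bochner_integral lborel (f n) (pi / (2 * pi * real n + b) - pi / (2 * pi * real n + a))" for n
    unfolding f_def by (intro has_bochner_integral_diff g assms)
  have g_le: "g c n x \<le> g d n x" if "d \<le> c" "d > 0" for c d n x
    unfolding g_def using pos[OF that(2), of n] that
    by (intro scaleR_left_mono divide_left_mono add_right_mono power_mono mult_pos_pos add_pos_nonneg) auto
  \<comment> \<open>The sign of \<open>f n\<close> depends only on the order of \<open>a\<close> and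
    \<open>b\<close>, so the integral of its absolute value is the absolute value of its
    integral.\<close>
  have abs_f: "has_bochner_integral lborel (\<lambda>x. norm (f n x))
      \<bar>pi / (2 * pi * real n + b) - pi / (2 * pi * real n + a)\<bar>" for n
  proof (cases "a \<le> b")
    case True
    then have "norm (f n x) = - f n x" for x
      using g_le[of a b n x] assms by (simp add: f_def)
    moreover have "\<bar>pi / (2 * pi * real n + b) - pi / (2 * pi * real n + a)\<bar> =
        - (pi / (2 * pi * real n + b) - pi / (2 * pi * real n + a))"
      using True pos[of a n] assms by (intro abs_of_nonpos) (auto intro!: divide_left_mono mult_pos_pos pos)
    ultimately show ?thesis using has_bochner_integral_minus[OF f] by simp
  next
    case False
    then have "norm (f n x) = f n x" for x
      using g_le[of b a n x] assms by (simp add: f_def)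
    moreover have "\<bar>pi / (2 * pi * real n + b) - pi / (2 * pi * real n + a)\<bar> =
        (pi / (2 * pi * real n + b) - pi / (2 * pi * real n + a))"
      using False pos[of a n] assms by (intro abs_of_nonneg) (auto intro!: divide_left_mono mult_pos_pos pos)
    ultimately show ?thesis using f by simp
  qed
  have sumg: "summable (\<lambda>n. g c n x)" if "c > 0" for c x
  proof (rule summable_comparison_test')
    show "summable (\<lambda>n. 2 * (1 / (2 * pi * real n + c) ^ (0 + 2)))"
      by (intro summable_mult summable_shifted_inverse_power that)
    show "norm (g c n x) \<le> 2 * (1 / (2 * pi * real n + c) ^ (0 + 2))" for n
      using pos[OF that, of n] by (auto simp: g_def indicator_def power2_eq_square intro!: divide_left_mono mult_pos_pos add_pos_nonneg)
  qed
  let ?d = "\<lambda>n. 1 / (2 * pi * real n + b) - 1 / (2 * pi * real n + a)"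
  have d: "norm (?d n) \<le> \<bar>a - b\<bar> * (1 / (2 * pi * real n + min a b) ^ (0 + 2))" for n
  proof -
    have "?d n = (a - b) / ((2 * pi * real n + b) * (2 * pi * real n + a))"
      using pos[of a n] pos[of b n] assms by (simp add: diff_divide_eq_iff divide_diff_eq_iff mult.commute)
    then have "norm (?d n) = \<bar>a - b\<bar> / ((2 * pi * real n + b) * (2 * pi * real n + a))"
      using pos[of a n] pos[of b n] assms by (simp add: abs_mult)
    also have "\<dots> \<le> \<bar>a - b\<bar> / ((2 * pi * real n + min a b) * (2 * pi * real n + min a b))"
      using pos[of a n] pos[of b n] pos[of "min a b" n] assms
      by (intro divide_left_mono mult_mono mult_pos_pos) auto
    finally show ?thesis by (simp add: power2_eq_square)
  qed
  have "summable (\<lambda>n. norm (?d n))"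
  proof (rule summable_comparison_test')
    show "summable (\<lambda>n. \<bar>a - b\<bar> * (1 / (2 * pi * real n + min a b) ^ (0 + 2)))"
      by (intro summable_mult summable_shifted_inverse_power) (use assms in simp)
  qed (use d in \<open>simp only: real_norm_def abs_abs\<close>)
  then have norm_d: "summable (\<lambda>n. \<bar>pi * ?d n\<bar>)"
    unfolding abs_mult real_norm_def by (rule summable_mult)
  have d_eq: "pi / (2 * pi * real n + b) - pi / (2 * pi * real n + a) = pi * ?d n" for n
    by (simp add: right_diff_distrib)
  have abs_summable: "AE x in lborel. summable (\<lambda>n. norm (f n x))"
  proof (intro AE_I2 summable_comparison_test'[OF summable_add[OF sumg[OF assms(1)] sumg[OF assms(2)]]])
    show "norm (norm (f n x)) \<le> g a n x + g b n x" for n x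
      unfolding f_def by (auto simp: g_def indicator_def intro!: order_trans[OF abs_triangle_ineq4])
  qed
  have integral_summable: "summable (\<lambda>n. \<integral>x. norm (f n x) \<partial>lborel)"
    unfolding has_bochner_integral_integral_eq[OF abs_f] d_eq by (rule norm_d)
  have int_f: "integrable lborel (f n)" for n
    using f by (rule integrable.intros)
  have "has_bochner_integral lborel (\<lambda>x. \<Sum>n. f n x) (\<Sum>n. pi * ?d n)"
    using integrable_suminf[OF int_f abs_summable integral_summable]
          integral_suminf[OF int_f abs_summable integral_summable]
    by (simp add: has_bochner_integral_iff has_bochner_integral_integral_eq[OF f] d_eq)
  moreover have "(\<lambda>x. \<Sum>n. f n x) = (\<lambda>x. indicator {0<..} x *\<^sub>R (\<Sum>n. 2 / ((2 * pi * n + b)\<^sup>2 + x\<^sup>2) - 2 / ((2 * pi * n + a)\<^sup>2 + x\<^sup>2)))"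
    by (auto simp: f_def g_def fun_eq_iff indicator_def)
  moreover have "(\<Sum>n. pi * ?d n) = pi * (\<Sum>n. ?d n)"
    using \<open>summable (\<lambda>n. norm (?d n))\<close> by (intro suminf_mult) (rule summable_norm_cancel)
  ultimately show ?thesis by simp
qed

subsection \<open>Generating function of the integrals\<close>

text \<open>The derivative of \<open>x * cosh x - sinh x\<close> is \<open>x * sinh x\<close>, which
  is nonnegative.\<close>

lemma sinh_le_mult_cosh:
  fixes x :: real
  assumes "x \<ge> 0"
  shows "sinh x \<le> x * cosh x"
proof -
  have "0 * cosh 0 - sinh 0 \<le> x * cosh x - sinh x"
    by (rule DERIV_nonneg_imp_nondecreasing[OF assms])
       (auto intro!: exI derivative_eq_intros mult_nonneg_nonneg)
  then show ?thesis by simp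
qed

lemma inverse_cosh_le:
  fixes x :: real
  assumes "x \<ge> 0"
  shows "1 / cosh x \<le> 4 / (1 + x\<^sup>2)"
proof -
  have "1 + x + x\<^sup>2 / 2 \<le> exp x"
    using assms by (rule exp_lower_Taylor_quadratic)
  also have "exp x \<le> 2 * cosh x"
    by (simp add: cosh_field_def)
  finally have "(1 + x\<^sup>2) / 4 \<le> cosh x"
    using assms by simp
  then show ?thesis
    by (simp add: divide_simps add_pos_nonneg)
qed

text \<open>One factor \<open>cosh x\<close> absorbs \<open>sinh x / x\<close>, a second one
  provides the decay, and the other \<open>n\<close> are at least 1.\<close>

lemma sinh_over_cosh_power_le:
  fixes x :: real
  assumes "x > 0"
  shows "sinh x / (x * cosh x ^ (n + 2)) \<le> 4 / (1 + x\<^sup>2)"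
proof -
  have "sinh x / (x * cosh x ^ (n + 2)) = sinh x / (x * cosh x) * (1 / cosh x ^ n) * (1 / cosh x)"
    by (simp add: power_add)
  also have "\<dots> \<le> 1 * 1 * (1 / cosh x)"
    using assms sinh_le_mult_cosh[of x] cosh_real_ge_1[of x]
    by (intro mult_mono) auto
  also have "\<dots> \<le> 4 / (1 + x\<^sup>2)"
    using inverse_cosh_le[of x] assms by simp
  finally show ?thesis .
qed

text \<open>This is J_n of the overview. The integral converges exactly for
  \<open>n \<ge> 2\<close>: already for \<open>n = 1\<close> the integrand decays only like
  \<open>1 / x\<close>.\<close>

definition sinh_cosh_integral :: "nat \<Rightarrow> real" where
  "sinh_cosh_integral n = (LINT x|lborel. indicator {0<..} x *\<^sub>R (sinh x / (x * cosh x ^ n)))"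

lemma integrable_sinh_over_cosh_power:
  assumes "n \<ge> 2"
  shows "integrable lborel (\<lambda>x::real. indicator {0<..} x *\<^sub>R (sinh x / (x * cosh x ^ n)))"
proof (rule Bochner_Integration.integrable_bound)
  \<comment> \<open>The majorant \<open>4 / (1 + x\<^sup>2)\<close>, written as twice the Lorentzian
    with \<open>b = 1\<close>.\<close>
  show "integrable lborel (\<lambda>x::real. 2 * (indicator {0<..} x *\<^sub>R (2 / (1\<^sup>2 + x\<^sup>2))))"
    using integrable.intros[OF has_bochner_integral_inverse_sum_squares[of 1]]
    by (intro integrable_mult_right) simp
  obtain k where k: "n = k + 2" using assms by (metis le_add_diff_inverse2)
  show "AE x::real in lborel. norm (indicator {0<..} x *\<^sub>R (sinh x / (x * cosh x ^ n)))
          \<le> norm (2 * (indicator {0<..} x *\<^sub>R (2 / (1\<^sup>2 + x\<^sup>2))))"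
    using sinh_over_cosh_power_le[of _ k] by (auto simp: indicator_def k abs_mult)
  have [measurable]: "sinh \<in> borel_measurable (borel :: real measure)" "cosh \<in> borel_measurable (borel :: real measure)"
    by (intro borel_measurable_continuous_onI continuous_intros)+
  show "(\<lambda>x::real. indicator {0<..} x *\<^sub>R (sinh x / (x * cosh x ^ n))) \<in> borel_measurable lborel"
    by measurable
qed

text \<open>The integrand is expanded geometrically in \<open>z\<close>, using
  \<open>\<bar>z\<bar> < 1 \<le> cosh x\<close>, and integrated termwise.\<close>

lemma sinh_cosh_integral_generating_function:
  fixes z :: real
  assumes "\<bar>z\<bar> < 1"
  shows "(\<lambda>n. z ^ (n + 1) * sinh_cosh_integral (n + 2)) sums
    (LINT x|lborel. indicator {0<..} x *\<^sub>R (sinh x / (x * (cosh x - z)) - sinh x / (x * cosh x)))"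
proof -
  define f where "f n x = z ^ (n + 1) * (indicator {0<..} x *\<^sub>R (sinh x / (x * cosh x ^ (n + 2))))"
    for n and x :: real
  have norm_f: "norm (f n x) = \<bar>z\<bar> ^ (n + 1) * (indicator {0<..} x *\<^sub>R (sinh x / (x * cosh x ^ (n + 2))))" for n x
    by (simp add: f_def abs_mult power_abs indicator_def)
  have geo: "(\<lambda>n. z ^ (n + 1) * (indicator {0<..} x *\<^sub>R (sinh x / (x * cosh x ^ (n + 2))))) sums
      (indicator {0<..} x *\<^sub>R (sinh x / (x * (cosh x - z)) - sinh x / (x * cosh x)))"
    if "\<bar>z\<bar> < 1" for x z :: real
  proof -
    have "\<bar>z\<bar> < cosh x" using that cosh_real_ge_1[of x] by simp
    from sums_mult[OF geometric_sums_diff_inverse[OF this], of "indicator {0<..} x *\<^sub>R (sinh x / x)"]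
    show ?thesis by (simp add: right_diff_distrib mult_ac)
  qed
  have integrable: "integrable lborel (f n)" for n
    unfolding f_def by (intro integrable_mult_right integrable_sinh_over_cosh_power) simp
  have summable: "AE x in lborel. summable (\<lambda>n. norm (f n x))"
    unfolding norm_f using geo[of "\<bar>z\<bar>"] assms by (auto simp: sums_iff)
  have "0 \<le> sinh_cosh_integral n" for n
    unfolding sinh_cosh_integral_def by (rule Bochner_Integration.integral_nonneg) (simp add: indicator_def)
  \<comment> \<open>This uniform bound makes the integrals of the norms a series dominated by a
    geometric one in \<open>\<bar>z\<bar>\<close>.\<close>
  moreover have "sinh_cosh_integral (n + 2) \<le> sinh_cosh_integral 2" for n
    unfolding sinh_cosh_integral_def
  proof (rule integral_mono[OF integrable_sinh_over_cosh_power integrable_sinh_over_cosh_power])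
    show "indicator {0<..} x *\<^sub>R (sinh x / (x * cosh x ^ (n + 2))) \<le> indicator {0<..} x *\<^sub>R (sinh x / (x * cosh x ^ 2))" for x :: real
      using power_increasing[of 2 "n + 2" "cosh x"] cosh_real_ge_1[of x]
      by (auto simp: indicator_def simp del: power_Suc power_add add_2_eq_Suc' intro!: divide_left_mono mult_left_mono)
  qed simp_all
  moreover have "(\<integral>x. norm (f n x) \<partial>lborel) = \<bar>z\<bar> ^ (n + 1) * sinh_cosh_integral (n + 2)" for n
    unfolding norm_f sinh_cosh_integral_def by (rule integral_mult_right_zero)
  ultimately have le: "norm (\<integral>x. norm (f n x) \<partial>lborel) \<le> \<bar>z\<bar> ^ n * (\<bar>z\<bar> * sinh_cosh_integral 2)" for n
    by (auto simp: abs_mult mult_ac intro!: mult_right_mono mult_left_mono)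
  have "summable (\<lambda>n. \<bar>z\<bar> ^ n * (\<bar>z\<bar> * sinh_cosh_integral 2))"
    using assms by (intro summable_mult2 summable_geometric) simp
  then have summable': "summable (\<lambda>n. \<integral>x. norm (f n x) \<partial>lborel)"
    by (rule summable_comparison_test') (rule le)
  have "(\<integral>x. f n x \<partial>lborel) = z ^ (n + 1) * sinh_cosh_integral (n + 2)" for n
    unfolding f_def sinh_cosh_integral_def by (rule integral_mult_right_zero)
  moreover have "(\<Sum>n. f n x) = indicator {0<..} x *\<^sub>R (sinh x / (x * (cosh x - z)) - sinh x / (x * cosh x))" for x
    unfolding f_def using geo[OF assms, of x] by (simp add: sums_iff)
  ultimately show ?thesis
    using sums_integral[OF integrable summable summable'] by simp
qed

text \<open>The numbers \<open>residue_sum q\<close> are the coefficients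
  $\pi \sum_j (-1)^{jq} a_j^{-q-1}$ with $a_j = (2j+1)\pi/2$, the even and odd \<open>j\<close> being paired.\<close>

definition residue_sum :: "nat \<Rightarrow> real" where
  "residue_sum q = pi * (shifted_zeta (pi / 2) (q + 1) + (-1) ^ q * shifted_zeta (3 * pi / 2) (q + 1))"

text \<open>One integral is expanded in two ways, in powers of \<open>sin t\<close> and in powers of
  \<open>t\<close>. The second comes from \<open>sin t = cos (pi / 2 - t)\<close>: the Lorentzian
  series with \<open>\<phi> = pi / 2 - t\<close>, minus the same series at \<open>t = 0\<close>, is
  integrated termwise.\<close>

lemma sinh_cosh_integral_residue_sum:
  fixes t :: real
  assumes "\<bar>t\<bar> < pi / 2"
  defines "I \<equiv> LINT x|lborel. indicator {0<..} x *\<^sub>R (sinh x / (x * (cosh x - sin t)) - sinh x / (x * cosh x))"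
  shows "(\<lambda>n. sin t ^ (n + 1) * sinh_cosh_integral (n + 2)) sums I"
    and "(\<lambda>q. t ^ (q + 1) * residue_sum (q + 1)) sums I"
proof -
  have cos: "cos t > 0" using assms by (intro cos_gt_zero_pi) auto
  have "sin t ^ 2 < 1" using cos sin_squared_eq[of t] by simp
  then have "\<bar>sin t\<bar> < 1" by (simp add: abs_square_less_1)
  then show "(\<lambda>n. sin t ^ (n + 1) * sinh_cosh_integral (n + 2)) sums I"
    unfolding I_def by (rule sinh_cosh_integral_generating_function)
  define h where "h a x n = 2 / ((2 * pi * real n + a)\<^sup>2 + x\<^sup>2)" for a x n
  define H where "H a b x = indicator {0<..} x *\<^sub>R (\<Sum>n. h b x n - h a x n)" for a b and x :: real
  define S where "S a b = (\<Sum>n. 1 / (2 * pi * real n + b) - 1 / (2 * pi * real n + a))" for a b :: real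
  have H: "has_bochner_integral lborel (H a b) (pi * S a b)" if "a > 0" "b > 0" for a b
    using has_bochner_integral_suminf_lorentzian_diff[OF that] unfolding H_def h_def S_def .
  have "H (pi / 2) (pi / 2 - t) x + H (3 * pi / 2) (3 * pi / 2 + t) x =
    indicator {0<..} x *\<^sub>R (sinh x / (x * (cosh x - sin t)) - sinh x / (x * cosh x))" for x
  proof (cases "x > 0")
    case True
    have sums: "summable (h a x)" if "a > 0" for a
      unfolding h_def
    proof (rule summable_comparison_test')
      show "summable (\<lambda>n. 2 * (1 / (2 * pi * real n + a) ^ (0 + 2)))"
        by (intro summable_mult summable_shifted_inverse_power that)
      show "norm (2 / ((2 * pi * real n + a)\<^sup>2 + x\<^sup>2)) \<le> 2 * (1 / (2 * pi * real n + a) ^ (0 + 2))" for n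
      proof -
        have "2 * pi * real n + a > 0" using that by (simp add: add_nonneg_pos)
        then show ?thesis
          by (auto simp: power2_eq_square intro!: divide_left_mono mult_pos_pos add_pos_nonneg)
      qed
    qed
    have 1: "(\<lambda>n. h (pi / 2 - t) x n + h (3 * pi / 2 + t) x n) sums (sinh x / (x * (cosh x - sin t)))"
      using sinh_over_cosh_minus_cos_sums[OF True, of "pi / 2 - t"]
      by (simp add: h_def cos_diff algebra_simps)
    have 2: "(\<lambda>n. h (pi / 2) x n + h (3 * pi / 2) x n) sums (sinh x / (x * cosh x))"
      using sinh_over_cosh_minus_cos_sums[OF True, of "pi / 2"]
      by (simp add: h_def algebra_simps)
    have "H (pi / 2) (pi / 2 - t) x + H (3 * pi / 2) (3 * pi / 2 + t) x =
       (\<Sum>n. (h (pi / 2 - t) x n - h (pi / 2) x n) + (h (3 * pi / 2 + t) x n - h (3 * pi / 2) x n))"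
    proof -
      have "summable (\<lambda>n. h (pi / 2 - t) x n - h (pi / 2) x n)"
           "summable (\<lambda>n. h (3 * pi / 2 + t) x n - h (3 * pi / 2) x n)"
        using assms(1) by (intro summable_diff sums; simp)+
      from suminf_add[OF this] show ?thesis
        using True by (simp add: H_def)
    qed
    \<comment> \<open>Termwise integration pairs shifted with unshifted terms inside each
      progression; the closed forms \<open>1\<close> and \<open>2\<close> instead pair the two
      progressions.\<close>
    also have "\<dots> = (\<Sum>n. (h (pi / 2 - t) x n + h (3 * pi / 2 + t) x n) - (h (pi / 2) x n + h (3 * pi / 2) x n))"
      by (simp add: algebra_simps)
    also have "\<dots> = sinh x / (x * (cosh x - sin t)) - sinh x / (x * cosh x)"
      using sums_diff[OF 1 2] by (simp add: sums_iff)
    finally show ?thesis using True by simp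
  qed (simp add: H_def)
  with has_bochner_integral_add[OF H[of "pi / 2" "pi / 2 - t"] H[of "3 * pi / 2" "3 * pi / 2 + t"]] assms(1)
  have "I = pi * S (pi / 2) (pi / 2 - t) + pi * S (3 * pi / 2) (3 * pi / 2 + t)"
    unfolding I_def by (intro has_bochner_integral_integral_eq) auto
  \<comment> \<open>The progression starting at \<open>3 * pi / 2\<close> moves by
    \<open>+ t\<close>, so its generating function is taken at \<open>- t\<close>. This is the
    source of the sign in \<open>residue_sum\<close>.\<close>
  moreover have "(\<lambda>q. pi * (t ^ (q + 1) * shifted_zeta (pi / 2) (q + 2)) +
      pi * ((- t) ^ (q + 1) * shifted_zeta (3 * pi / 2) (q + 2)))
     sums (pi * S (pi / 2) (pi / 2 - t) + pi * S (3 * pi / 2) (3 * pi / 2 + t))"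
    using shifted_zeta_generating_function[of t "pi / 2"]
          shifted_zeta_generating_function[of "-t" "3 * pi / 2"] assms(1)
    unfolding S_def by (intro sums_add sums_mult) (auto simp: algebra_simps)
  moreover have "pi * (t ^ (q + 1) * shifted_zeta (pi / 2) (q + 2)) +
      pi * ((- t) ^ (q + 1) * shifted_zeta (3 * pi / 2) (q + 2)) = t ^ (q + 1) * residue_sum (q + 1)" for q
    unfolding residue_sum_def by (subst power_minus) (simp add: algebra_simps)
  ultimately show "(\<lambda>q. t ^ (q + 1) * residue_sum (q + 1)) sums I"
    by simp
qed

subsection \<open>Comparison of power series\<close>

text \<open>Zeros of a nonzero analytic germ are isolated, so agreement at points accumulating at 0
  suffices. It is applied to functions compared on the real axis only.\<close>

lemma has_fps_expansion_eqI_frequently: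
  fixes f g :: "complex \<Rightarrow> complex"
  assumes "f has_fps_expansion F" "g has_fps_expansion G"
  assumes "frequently (\<lambda>z. f z = g z) (at 0)"
  shows "F = G"
proof -
  have "(\<lambda>z. f z - g z) has_fps_expansion F - G"
    using assms by (intro fps_expansion_intros)
  from has_laurent_expansion_fps[OF this]
  have "(\<lambda>z. f (0 + z) - g (0 + z)) has_laurent_expansion fps_to_fls (F - G)"
    by (simp only: add_0)
  from has_laurent_expansion_frequently_zero_iff[OF this] show ?thesis
    using assms(3) by (auto simp: fps_to_fls_eq_0_iff simp del: fps_to_fls_minus)
qed

text \<open>Composition with \<open>- fps_X\<close> multiplies the coefficient of index
  \<open>n\<close> by \<open>(- 1) ^ n\<close>; uniqueness of expansions then compares it with
  \<open>c * f\<close>.\<close>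

lemma has_fps_expansion_parity:
  fixes f :: "complex \<Rightarrow> complex"
  assumes "f has_fps_expansion F" "\<forall>\<^sub>F z in nhds 0. f (- z) = c * f z"
  shows "(- 1) ^ n * fps_nth F n = c * fps_nth F n"
proof -
  define G where "G = fps_const (-1 :: complex) * fps_X"
  have "(f \<circ> (\<lambda>z. - 1 * z)) has_fps_expansion (F oo G)"
    unfolding G_def
    by (intro has_fps_expansion_compose fps_expansion_intros assms(1)) simp
  moreover have "(\<lambda>z. c * f z) has_fps_expansion fps_const c * F"
    by (intro fps_expansion_intros assms(1))
  moreover have "\<forall>\<^sub>F z in nhds 0. (f \<circ> (\<lambda>z. - 1 * z)) z = c * f z"
    using assms(2) by simp
  ultimately have "F oo G = fps_const c * F"
    using fps_expansion_unique_complex has_fps_expansion_cong by metis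
  moreover have "fps_nth (F oo G) n = (- 1) ^ n * fps_nth F n"
  proof -
    have "fps_nth (F oo G) n = (\<Sum>i = 0..n. fps_nth F i * ((- 1) ^ i * (if n = i then 1 else 0)))"
      unfolding fps_compose_nth G_def power_mult_distrib fps_const_power fps_mult_left_const_nth
        fps_X_power_nth ..
    also have "\<dots> = (\<Sum>i = 0..n. if n = i then fps_nth F i * (- 1) ^ i else 0)"
      by (intro sum.cong) auto
    finally show ?thesis by simp
  qed
  ultimately show ?thesis by (metis fps_mult_left_const_nth)
qed

section \<open>The principal arcsine near the origin\<close>

lemma analytic_Arcsin_0: "Arcsin analytic_on {0}"
proof -
  have "Arcsin holomorphic_on ball 0 1"
  proof (rule holomorphic_on_Arcsin)
    show "\<bar>Re z\<bar> < 1" if "z \<in> ball 0 1" for z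
      using that abs_Re_le_cmod[of z] by simp
  qed
  then show ?thesis
    by (metis analytic_at centre_in_ball open_ball zero_less_one)
qed

lemma Arcsin_has_fps_expansion: "Arcsin has_fps_expansion fps_expansion Arcsin 0"
  by (intro analytic_at_imp_has_fps_expansion_0 analytic_Arcsin_0)

text \<open>Both sides lie in the strip where the real part is less than \<open>pi / 2\<close> in
  absolute value, and \<open>sin\<close> is injective there.\<close>

lemma Arcsin_uminus:
  assumes "\<bar>Re z\<bar> < 1"
  shows "Arcsin (- z) = - Arcsin z"
  using Arcsin_bounds[OF assms] by (intro Arcsin_unique) auto

text \<open>The index shift is that of the generating function in the overview; the constant term is
  0 because the value at \<open>z = 0\<close> is subtracted there.\<close>

definition sinh_cosh_fps :: "complex fps" where
  "sinh_cosh_fps = Abs_fps (\<lambda>n. if n = 0 then 0 else of_real (sinh_cosh_integral (n + 1)))"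

definition residue_fps :: "complex fps" where
  "residue_fps = Abs_fps (\<lambda>q. if q = 0 then 0 else of_real (residue_sum q))"

text \<open>The two series have equal sums at \<open>sin t\<close> and at \<open>t\<close>. With
  \<open>t = arcsin x\<close> the analytic functions on both sides agree on a real interval around
  0, hence so do their expansions.\<close>

lemma sinh_cosh_fps_eq: "sinh_cosh_fps = residue_fps oo fps_expansion Arcsin 0"
proof -
  have sums: "\<exists>s. (\<lambda>n. fps_nth sinh_cosh_fps n * of_real (sin t) ^ n) sums s \<and>
                  (\<lambda>q. fps_nth residue_fps q * of_real t ^ q) sums s"
    if "\<bar>t\<bar> < pi / 2" for t :: real
  proof -
    from sinh_cosh_integral_residue_sum[OF that] obtain I where
      "(\<lambda>n. sin t ^ (n + 1) * sinh_cosh_integral (n + 2)) sums I"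
      "(\<lambda>q. t ^ (q + 1) * residue_sum (q + 1)) sums I" by blast
    then have "(\<lambda>n. fps_nth sinh_cosh_fps (Suc n) * of_real (sin t) ^ Suc n) sums of_real I"
      "(\<lambda>q. fps_nth residue_fps (Suc q) * of_real t ^ Suc q) sums of_real I"
      by (auto dest!: sums_of_real[where 'a = complex] simp: sinh_cosh_fps_def residue_fps_def mult_ac)
    from this[THEN sums_Suc] show ?thesis
      by (intro exI[of _ "of_real I"]) (simp add: sinh_cosh_fps_def residue_fps_def)
  qed
  have pos: "fps_conv_radius sinh_cosh_fps > 0" "fps_conv_radius residue_fps > 0"
  proof -
    \<comment> \<open>Convergence for the single parameter \<open>t = 1\<close> bounds the two radii
      below by \<open>sin 1\<close> and 1.\<close>
    have "\<bar>1\<bar> < pi / 2" using pi_gt3 by simp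
    then obtain s where s: "(\<lambda>n. fps_nth sinh_cosh_fps n * of_real (sin 1) ^ n) sums s"
                  "(\<lambda>q. fps_nth residue_fps q * of_real 1 ^ q) sums s"
      using sums by blast
    have "sin 1 > (0 :: real)" using pi_gt3 by (intro sin_gt_zero) auto
    then have "0 < ereal (norm (of_real (sin 1) :: complex))" by simp
    also have "\<dots> \<le> fps_conv_radius sinh_cosh_fps"
      unfolding fps_conv_radius_def by (intro conv_radius_geI) (rule sums_summable[OF s(1)])
    finally show "fps_conv_radius sinh_cosh_fps > 0" .
    have "0 < ereal (norm (of_real 1 :: complex))" by simp
    also have "\<dots> \<le> fps_conv_radius residue_fps"
      unfolding fps_conv_radius_def by (intro conv_radius_geI) (rule sums_summable[OF s(2)])
    finally show "fps_conv_radius residue_fps > 0" .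
  qed
  have exp1: "eval_fps sinh_cosh_fps has_fps_expansion sinh_cosh_fps"
    and exp_residue: "eval_fps residue_fps has_fps_expansion residue_fps"
    using pos by (auto simp: has_fps_expansion_def)
  have exp2: "(eval_fps residue_fps \<circ> Arcsin) has_fps_expansion (residue_fps oo fps_expansion Arcsin 0)"
    by (intro has_fps_expansion_compose Arcsin_has_fps_expansion)
       (use exp_residue in \<open>auto simp: fps_expansion_def\<close>)
  have eq: "eval_fps sinh_cosh_fps (of_real x) = (eval_fps residue_fps \<circ> Arcsin) (of_real x)"
    if "\<bar>x\<bar> < 1" for x :: real
  proof -
    have "\<bar>arcsin x\<bar> < pi / 2" using arcsin_lt_bounded[of x] that by linarith
    from sums[OF this] that show ?thesis
      by (auto simp: eval_fps_def sums_iff of_real_arcsin[symmetric])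
  qed
  have "frequently (\<lambda>z. eval_fps sinh_cosh_fps z = (eval_fps residue_fps \<circ> Arcsin) z) (at 0)"
    unfolding frequently_at
  proof safe
    fix d :: real assume d: "d > 0"
    define x where "x = min (d / 2) (1 / 2)"
    have x: "x > 0" "x < d" "\<bar>x\<bar> < 1" using d by (auto simp: x_def)
    then show "\<exists>z\<in>UNIV. z \<noteq> 0 \<and> dist z 0 < d \<and> eval_fps sinh_cosh_fps z = (eval_fps residue_fps \<circ> Arcsin) z"
      by (intro bexI[of _ "of_real x"] conjI eq) auto
  qed
  with exp1 exp2 show ?thesis
    by (rule has_fps_expansion_eqI_frequently)
qed

subsection \<open>Zeta and beta values\<close>

lemma shifted_zeta_sums:
  assumes "a > 0" "s \<ge> 2"
  shows "(\<lambda>n. 1 / (2 * pi * real n + a) ^ s) sums shifted_zeta a s"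
proof -
  obtain q where "s = q + 2" using assms(2) by (metis le_add_diff_inverse2)
  then show ?thesis
    unfolding shifted_zeta_def using summable_shifted_inverse_power[OF assms(1), of q]
    by (auto simp: sums_iff)
qed

text \<open>The two progressions are the even and the odd \<open>j\<close> in
  \<open>pi * j + pi / 2\<close>; taking out \<open>pi / 2\<close> leaves the odd number
  \<open>2 * j + 1\<close>.\<close>

lemma residue_sum_eq:
  assumes "q \<ge> 1"
  shows "residue_sum q = pi * (2 / pi) ^ (q + 1) * (\<Sum>n. (- 1) ^ (q * n) / real (2 * n + 1) ^ (q + 1))"
proof -
  define f where "f n = (- 1) ^ (q * n) / real (2 * n + 1) ^ (q + 1)" for n
  have "summable (\<lambda>n. inverse (real (Suc n) ^ (q + 1)))"
    using inverse_power_summable[of "q + 1", where 'a = real] assms by (subst summable_Suc_iff) auto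
  then have "summable f"
  proof (rule summable_comparison_test')
    show "norm (f n) \<le> inverse (real (Suc n) ^ (q + 1))" for n
      unfolding f_def norm_divide norm_power
      by (simp add: inverse_eq_divide del: power_Suc of_nat_Suc of_nat_add, intro divide_left_mono power_mono mult_pos_pos) auto
  qed
  then have "f sums suminf f" by (rule summable_sums)
  then have "(\<lambda>n. (2 / pi) ^ (q + 1) * f n) sums ((2 / pi) ^ (q + 1) * suminf f)"
    by (rule sums_mult)
  from sums_group[OF this, of 2]
  have 1: "(\<lambda>n. (2 / pi) ^ (q + 1) * f (n * 2) + (2 / pi) ^ (q + 1) * f (Suc (n * 2))) sums ((2 / pi) ^ (q + 1) * suminf f)"
    by (simp add: numeral_2_eq_2)
  have f: "(2 / pi) ^ (q + 1) * f n = (- 1) ^ (q * n) * (1 / (pi * real n + pi / 2) ^ (q + 1))" for n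
  proof -
    have "(2 / pi) ^ (q + 1) * f n = (- 1) ^ (q * n) * ((2 / pi) / real (2 * n + 1)) ^ (q + 1)"
      unfolding f_def power_divide by simp
    also have "(2 / pi) / real (2 * n + 1) = 1 / (pi * real n + pi / 2)"
      by (simp add: field_simps)
    finally show ?thesis by (simp only: power_divide power_one)
  qed
  have "(\<lambda>n. 1 / (2 * pi * real n + pi / 2) ^ (q + 1) + (- 1) ^ q * (1 / (2 * pi * real n + 3 * pi / 2) ^ (q + 1)))
     sums (shifted_zeta (pi / 2) (q + 1) + (- 1) ^ q * shifted_zeta (3 * pi / 2) (q + 1))"
    using assms by (intro sums_add sums_mult shifted_zeta_sums) auto
  moreover have "1 / (2 * pi * real n + pi / 2) ^ (q + 1) + (- 1) ^ q * (1 / (2 * pi * real n + 3 * pi / 2) ^ (q + 1))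
      = (2 / pi) ^ (q + 1) * f (n * 2) + (2 / pi) ^ (q + 1) * f (Suc (n * 2))" for n
  proof -
    have "even (q * (n * 2))" by simp
    then have "(- 1 :: real) ^ (q * (n * 2)) = 1" "(- 1 :: real) ^ (q * Suc (n * 2)) = (- 1) ^ q"
      by (simp_all only: mult_Suc_right power_add neg_one_even_power mult_1_right)
    moreover have "pi * real (n * 2) + pi / 2 = 2 * pi * real n + pi / 2"
       "pi * real (Suc (n * 2)) + pi / 2 = 2 * pi * real n + 3 * pi / 2"
      by (simp_all add: field_simps)
    ultimately show ?thesis by (simp only: f mult_1_left)
  qed
  ultimately have "shifted_zeta (pi / 2) (q + 1) + (- 1) ^ q * shifted_zeta (3 * pi / 2) (q + 1) =
      (2 / pi) ^ (q + 1) * suminf f"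
    using 1 by (simp only: sums_unique2)
  then show ?thesis
    unfolding residue_sum_def by (simp only: f_def[abs_def] mult.assoc)
qed

text \<open>The even terms contribute \<open>1 / 2 ^ s\<close> times the whole series.\<close>

lemma suminf_odd_inverse_powers:
  assumes "s \<ge> 2"
  shows "(\<Sum>n. 1 / real (2 * n + 1) ^ s) = (1 - 1 / 2 ^ s) * (\<Sum>n. 1 / real (n + 1) ^ s)"
proof -
  have "summable (\<lambda>n. 1 / real (n + 1) ^ s)"
    using inverse_power_summable[of s, where 'a = real] assms
    by (subst summable_iff_shift) (simp add: inverse_eq_divide)
  then have Z: "(\<lambda>n. 1 / real (n + 1) ^ s) sums (\<Sum>n. 1 / real (n + 1) ^ s)"
    by (rule summable_sums)
  from sums_group[OF Z, of 2]
  have "(\<lambda>n. 1 / real (2 * n + 1) ^ s + 1 / real (2 * n + 2) ^ s) sums (\<Sum>n. 1 / real (n + 1) ^ s)"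
    by (simp add: numeral_2_eq_2 mult.commute)
  moreover have "(\<lambda>n. 1 / 2 ^ s * (1 / real (n + 1) ^ s)) sums (1 / 2 ^ s * (\<Sum>n. 1 / real (n + 1) ^ s))"
    by (rule sums_mult[OF Z])
  moreover have "1 / 2 ^ s * (1 / real (n + 1) ^ s) = 1 / real (2 * n + 2) ^ s" for n
    by (simp flip: power_mult_distrib)
  ultimately have "(\<lambda>n. (1 / real (2 * n + 1) ^ s + 1 / real (2 * n + 2) ^ s) - 1 / real (2 * n + 2) ^ s) sums
     ((\<Sum>n. 1 / real (n + 1) ^ s) - 1 / 2 ^ s * (\<Sum>n. 1 / real (n + 1) ^ s))"
    by (simp only: sums_diff)
  then show ?thesis
    by (simp add: sums_iff left_diff_distrib)
qed

lemma riemann_zeta_of_nat: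
  assumes "s \<ge> 2"
  shows "riemann_zeta (of_nat s) = of_real (\<Sum>n. 1 / real (n + 1) ^ s)"
proof -
  have "summable (\<lambda>n. 1 / real (n + 1) ^ s)"
    using inverse_power_summable[of s, where 'a = real] assms
    by (subst summable_iff_shift) (simp add: inverse_eq_divide)
  moreover have "1 / of_nat (n + 1) powr of_nat s = (of_real (1 / real (n + 1) ^ s) :: complex)" for n
    by (subst powr_nat') (auto simp del: of_nat_add of_nat_Suc)
  ultimately show ?thesis
    unfolding riemann_zeta_def by (simp only: suminf_of_real)
qed

lemma dirichlet_beta_of_nat:
  assumes "s \<ge> 2"
  shows "dirichlet_beta (of_nat s) = of_real (\<Sum>r. (- 1) ^ r / real (2 * r + 1) ^ s)"
proof -
  have "summable (\<lambda>n. inverse (real (Suc n) ^ s))"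
    using inverse_power_summable[of s, where 'a = real] assms by (subst summable_Suc_iff) auto
  then have "summable (\<lambda>r. (- 1) ^ r / real (2 * r + 1) ^ s)"
  proof (rule summable_comparison_test')
    show "norm ((- 1) ^ n / real (2 * n + 1) ^ s) \<le> inverse (real (Suc n) ^ s)" for n
      unfolding norm_divide norm_power
      by (simp add: inverse_eq_divide del: power_Suc of_nat_Suc of_nat_add, intro divide_left_mono power_mono mult_pos_pos) auto
  qed
  moreover have "(- 1) ^ r / of_nat (2 * r + 1) powr of_nat s = (of_real ((- 1) ^ r / real (2 * r + 1) ^ s) :: complex)" for r
    by (subst powr_nat') (auto simp del: of_nat_add of_nat_Suc)
  ultimately show ?thesis
    unfolding dirichlet_beta_def by (simp only: suminf_of_real)
qed

text \<open>At an even index all signs are \<open>+\<close>, and the odd inverse powers give the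
  zeta value times \<open>1 - 1 / 2 ^ (2 * p + 1)\<close>; the numerator
  \<open>2 ^ (2 * p + 1)\<close> clears this denominator.\<close>

lemma residue_sum_even:
  assumes "p \<ge> 1"
  shows "of_real (residue_sum (2 * p)) =
    (2 ^ (2 * p + 1) - 1) * (riemann_zeta (of_nat (2 * p + 1)) / complex_of_real pi ^ (2 * p))"
proof -
  have "residue_sum (2 * p) = pi * (2 / pi) ^ (2 * p + 1) * ((1 - 1 / 2 ^ (2 * p + 1)) * (\<Sum>n. 1 / real (n + 1) ^ (2 * p + 1)))"
    using assms by (subst residue_sum_eq, simp, subst suminf_odd_inverse_powers[symmetric])
      (auto simp: power_mult)
  also have "\<dots> = (2 ^ (2 * p + 1) - 1) * ((\<Sum>n. 1 / real (n + 1) ^ (2 * p + 1)) / pi ^ (2 * p))"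
  proof -
    have "pi * (T / (pi * P)) * ((1 - 1 / T) * Z) = (T - 1) * (Z / P)" if "T \<noteq> 0" for T P Z :: real
      using that by (cases "P = 0") (simp_all add: divide_simps right_diff_distrib)
    note this[of "2 ^ (2 * p + 1)"]
    moreover have "pi ^ (2 * p + 1) = pi * pi ^ (2 * p)" "(2 :: real) ^ (2 * p + 1) \<noteq> 0" by simp_all
    ultimately show ?thesis
      by (metis power_divide)
  qed
  finally show ?thesis
    using assms by (subst riemann_zeta_of_nat) auto
qed

text \<open>At an odd index the signs alternate, which produces the beta series at
  \<open>2 * p\<close>.\<close>

lemma residue_sum_odd:
  assumes "p \<ge> 1"
  shows "of_real (residue_sum (2 * p - 1)) =
    2 ^ (2 * p) * (dirichlet_beta (of_nat (2 * p)) / complex_of_real pi ^ (2 * p - 1))"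
proof -
  have q: "2 * p - 1 + 1 = 2 * p" "pi ^ (2 * p) = pi * pi ^ (2 * p - 1)"
    using assms by (auto simp flip: power_Suc)
  have "odd (2 * p - 1)" using assms by simp
  then have "(- 1 :: real) ^ ((2 * p - 1) * n) = (- 1) ^ n" for n
    by (simp add: power_mult)
  then have "residue_sum (2 * p - 1) = pi * (2 / pi) ^ (2 * p) * (\<Sum>r. (- 1) ^ r / real (2 * r + 1) ^ (2 * p))"
    using assms by (subst residue_sum_eq) (simp, simp only: q)
  also have "\<dots> = 2 ^ (2 * p) * ((\<Sum>r. (- 1) ^ r / real (2 * r + 1) ^ (2 * p)) / pi ^ (2 * p - 1))"
    unfolding power_divide q(2) by simp
  finally show ?thesis
    using assms by (subst dirichlet_beta_of_nat) auto
qed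

subsection \<open>Chebyshev polynomials and the main result\<close>

lemma poly_chebyshev_U_uminus: "poly (chebyshev_U m) (- z) = (- 1) ^ m * poly (chebyshev_U m) z"
proof (induction m rule: chebyshev_U.induct)
  case (3 m)
  then show ?case by (simp add: right_diff_distrib)
qed simp_all

text \<open>For \<open>n > 2 * k\<close> this bound leaves at least \<open>cosh x ^ 2\<close> in
  every denominator after division by the monomials of
  \<open>chebyshev_U (2 * k - 1)\<close>.\<close>

lemma degree_chebyshev_U_le: "degree (chebyshev_U m :: 'a :: comm_ring_1 poly) \<le> m"
proof (induction m rule: chebyshev_U.induct)
  case (3 m)
  have "degree ([:0, 2:] * chebyshev_U (Suc m) :: 'a poly) \<le> degree [:0, 2 :: 'a:] + degree (chebyshev_U (Suc m) :: 'a poly)"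
    by (rule degree_mult_le)
  also have "\<dots> \<le> 1 + Suc m"
    using 3 by (intro add_mono) auto
  finally have "degree ([:0, 2:] * chebyshev_U (Suc m) :: 'a poly) \<le> Suc (Suc m)"
    unfolding plus_1_eq_Suc .
  moreover have "degree (chebyshev_U m :: 'a poly) \<le> Suc (Suc m)"
    using 3 by linarith
  ultimately show ?case
    unfolding chebyshev_U.simps by (rule degree_diff_le)
qed auto

text \<open>The addition formulas for \<open>sinh (a + x)\<close> and \<open>sinh (a - x)\<close>
  reproduce the recurrence, as in the trigonometric case.\<close>

lemma chebyshev_U_cosh:
  fixes x :: real
  shows "poly (chebyshev_U m) (cosh x) * sinh x = sinh (real (m + 1) * x)"
proof (induction m rule: chebyshev_U.induct)
  case 2
  show ?case using sinh_double[of x] by (simp add: mult_ac)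
next
  case (3 m)
  let ?a = "real (m + 2) * x"
  have "sinh (real (m + 3) * x) = sinh (?a + x)" "sinh (real (m + 1) * x) = sinh (?a - x)"
    by (simp_all add: algebra_simps)
  hence "sinh (real (m + 3) * x) = 2 * cosh x * sinh ?a - sinh (real (m + 1) * x)"
    by (simp add: sinh_add sinh_diff)
  with 3 show ?case
    by (simp add: algebra_simps numeral_3_eq_3)
qed simp

lemma coeff_chebyshev_U_of_real:
  "coeff (chebyshev_U m :: complex poly) i = of_real (coeff (chebyshev_U m) i)"
proof (induction m arbitrary: i rule: chebyshev_U.induct)
  case 1
  show ?case by (simp add: coeff_1)
next
  case 2
  show ?case by (simp add: coeff_pCons split: nat.splits)
next
  case (3 m)
  then show ?case by (simp add: coeff_pCons split: nat.splits)
qed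

text \<open>Writing \<open>sinh (2 * k * x)\<close> as \<open>sinh x\<close> times the Chebyshev
  polynomial in \<open>cosh x\<close> gives a combination of the integrals J_{n-i}. Since J_{n-i} is
  the coefficient of index \<open>n - 1 - i\<close> of \<open>sinh_cosh_fps\<close>, this is a
  Cauchy product.\<close>

lemma has_integral_sinh_over_cosh_power:
  assumes "k \<ge> 1" "n > 2 * k"
  shows "((\<lambda>x::real. complex_of_real (sinh (2 * real k * x) / (x * cosh x ^ n))) has_integral
      fps_nth (fps_of_poly (chebyshev_U (2 * k - 1)) * sinh_cosh_fps) (n - 1)) {0<..}"
proof -
  define U where "U = (chebyshev_U (2 * k - 1) :: real poly)"
  have deg: "i < 2 * k" if "i \<le> degree U" for i
    using that degree_chebyshev_U_le[of "2 * k - 1", where 'a = real] assms by (simp add: U_def)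
  define I where "I = (\<Sum>i\<le>degree U. coeff U i * sinh_cosh_integral (n - i))"
  have bochner: "has_bochner_integral lborel (\<lambda>x. \<Sum>i\<le>degree U. coeff U i * (indicator {0<..} x *\<^sub>R (sinh x / (x * cosh x ^ (n - i))))) I"
    unfolding I_def
  proof (intro has_bochner_integral_sum has_bochner_integral_mult_right)
    show "has_bochner_integral lborel (\<lambda>x. indicator {0<..} x *\<^sub>R (sinh x / (x * cosh x ^ (n - i)))) (sinh_cosh_integral (n - i))"
      if "i \<in> {..degree U}" for i
      unfolding sinh_cosh_integral_def
      using deg[of i] that assms(2) by (intro has_bochner_integral_integrable integrable_sinh_over_cosh_power) auto
  qed
  have "(\<Sum>i\<le>degree U. coeff U i * (indicator {0<..} x *\<^sub>R (sinh x / (x * cosh x ^ (n - i))))) =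
      (if x \<in> {0<..} then sinh (2 * real k * x) / (x * cosh x ^ n) else 0)" for x :: real
  proof (cases "x > 0")
    case True
    have "sinh (2 * real k * x) = poly U (cosh x) * sinh x"
      using chebyshev_U_cosh[of "2 * k - 1" x] assms(1) by (simp add: U_def of_nat_diff)
    then have "sinh (2 * real k * x) / (x * cosh x ^ n) =
       (\<Sum>i\<le>degree U. coeff U i * cosh x ^ i * sinh x / (x * cosh x ^ n))"
      by (simp add: poly_altdef sum_distrib_right sum_divide_distrib)
    also have "\<dots> = (\<Sum>i\<le>degree U. coeff U i * (sinh x / (x * cosh x ^ (n - i))))"
    proof (intro sum.cong refl)
      fix i assume "i \<in> {..degree U}"
      then have "cosh x ^ n = cosh x ^ i * cosh x ^ (n - i)"
        using deg[of i] assms by (simp flip: power_add)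
      then show "coeff U i * cosh x ^ i * sinh x / (x * cosh x ^ n) = coeff U i * (sinh x / (x * cosh x ^ (n - i)))"
        by simp
    qed
    finally show ?thesis using True by simp
  qed simp
  with has_integral_integral_lborel[OF integrable.intros[OF bochner]]
  have "((\<lambda>x. if x \<in> {0<..} then sinh (2 * real k * x) / (x * cosh x ^ n) else 0) has_integral I) UNIV"
    using has_bochner_integral_integral_eq[OF bochner] by simp
  then have "((\<lambda>x::real. sinh (2 * real k * x) / (x * cosh x ^ n)) has_integral I) {0<..}"
    by (simp only: has_integral_restrict_UNIV)
  then have "((\<lambda>x::real. complex_of_real (sinh (2 * real k * x) / (x * cosh x ^ n))) has_integral of_real I) {0<..}"
    by (rule has_integral_of_real)
  moreover have "fps_nth (fps_of_poly (chebyshev_U (2 * k - 1)) * sinh_cosh_fps) (n - 1) = of_real I"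
  proof -
    have "fps_nth (fps_of_poly (chebyshev_U (2 * k - 1)) * sinh_cosh_fps) (n - 1) =
      (\<Sum>i = 0..n - 1. of_real (coeff U i) * fps_nth sinh_cosh_fps (n - 1 - i))"
      by (simp add: fps_mult_nth coeff_chebyshev_U_of_real U_def)
    also have "\<dots> = (\<Sum>i\<le>degree U. of_real (coeff U i) * fps_nth sinh_cosh_fps (n - 1 - i))"
      using assms by (intro sum.mono_neutral_right) (auto dest!: deg simp: coeff_eq_0)
    also have "\<dots> = of_real I"
      unfolding I_def of_real_sum of_real_mult
    proof (intro sum.cong refl arg_cong2[where f = times])
      \<comment> \<open>The index must avoid 0, where \<open>sinh_cosh_fps\<close> has the value 0
        by definition and not an integral.\<close>
      fix i assume "i \<in> {..degree U}"
      then have "n - 1 - i \<noteq> 0" "n - 1 - i + 1 = n - i" using deg[of i] assms by auto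
      then show "fps_nth sinh_cosh_fps (n - 1 - i) = of_real (sinh_cosh_integral (n - i))"
        by (simp add: sinh_cosh_fps_def)
    qed
    finally show ?thesis .
  qed
  ultimately show ?thesis by simp
qed

section \<open>Selection of the coefficients by parity\<close>

lemma chebyshev_U_Arcsin_has_fps_expansion:
  "(\<lambda>z. poly (chebyshev_U j) z * Arcsin z ^ q) has_fps_expansion
     (fps_of_poly (chebyshev_U j) * fps_expansion Arcsin 0 ^ q)"
proof -
  have "poly (chebyshev_U j) has_fps_expansion fps_of_poly (chebyshev_U j :: complex poly)"
    by (simp add: has_fps_expansion_def)
  then show ?thesis
    by (intro fps_expansion_intros Arcsin_has_fps_expansion)
qed

text \<open>The function has the parity of \<open>j + q\<close>, so the coefficients of the opposite
  parity vanish.\<close>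

lemma fps_expansion_chebyshev_U_Arcsin_eq_0:
  assumes "odd (j + q + n)"
  shows "fps_nth (fps_expansion (\<lambda>z. poly (chebyshev_U j) z * Arcsin z ^ q) 0) n = 0"
proof -
  let ?f = "\<lambda>z. poly (chebyshev_U j) z * Arcsin z ^ q"
  have "\<forall>\<^sub>F z :: complex in nhds 0. norm z < 1"
    using eventually_nhds_in_open[of "ball 0 1" "0 :: complex"] by simp
  then have "\<forall>\<^sub>F z in nhds 0. ?f (- z) = (- 1) ^ (j + q) * ?f z"
  proof eventually_elim
    case (elim z)
    then have "Arcsin (- z) = - Arcsin z"
      using abs_Re_le_cmod[of z] by (intro Arcsin_uminus) simp
    then have "Arcsin (- z) ^ q = (- 1) ^ q * Arcsin z ^ q"
      by (simp only: power_minus[of "Arcsin z"])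
    then show ?case
      by (simp add: poly_chebyshev_U_uminus power_add)
  qed
  from has_fps_expansion_parity[OF chebyshev_U_Arcsin_has_fps_expansion this, of n]
  have "(- 1) ^ n * fps_nth (fps_expansion ?f 0) n = (- 1) ^ (j + q) * fps_nth (fps_expansion ?f 0) n"
    by (simp only: fps_expansion_eqI[OF chebyshev_U_Arcsin_has_fps_expansion])
  with assms show ?thesis
    by (cases "even n") auto
qed

text \<open>The composition identity is inserted into the Cauchy product and the sum over
  \<open>q\<close> is moved outside. Parity then removes every \<open>q\<close> with
  \<open>q + n\<close> odd, and \<open>q = 0\<close> drops out because \<open>residue_fps\<close>
  has no constant term.\<close>

lemma has_integral_sinh_over_cosh_power_residue_sum:
  assumes "k \<ge> 1" "n > 2 * k"
  shows "((\<lambda>x::real. complex_of_real (sinh (2 * real k * x) / (x * cosh x ^ n))) has_integral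
      (\<Sum>q | 1 \<le> q \<and> q < n \<and> even (q + n). of_real (residue_sum q) *
         fps_nth (fps_expansion (\<lambda>z. poly (chebyshev_U (2 * k - 1)) z * Arcsin z ^ q) 0) (n - 1))) {0<..}"
proof -
  let ?U = "fps_of_poly (chebyshev_U (2 * k - 1)) :: complex fps"
  let ?A = "fps_expansion Arcsin 0"
  let ?c = "\<lambda>q. fps_nth (fps_expansion (\<lambda>z. poly (chebyshev_U (2 * k - 1)) z * Arcsin z ^ q) 0) (n - 1)"
  have A0: "fps_nth ?A 0 = 0" by (simp add: fps_expansion_def)
  have "fps_nth (?U * sinh_cosh_fps) (n - 1) =
     (\<Sum>i = 0..n - 1. fps_nth ?U i * (\<Sum>q = 0..n - 1 - i. fps_nth residue_fps q * fps_nth (?A ^ q) (n - 1 - i)))"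
    by (simp add: fps_mult_nth sinh_cosh_fps_eq fps_compose_nth)
  \<comment> \<open>The series of \<open>Arcsin\<close> starts in degree 1, so its power
    \<open>q\<close> has no coefficient below \<open>q\<close>; the range of \<open>q\<close> can
    thus be made independent of \<open>i\<close>.\<close>
  also have "\<dots> = (\<Sum>i = 0..n - 1. fps_nth ?U i * (\<Sum>q = 0..n - 1. fps_nth residue_fps q * fps_nth (?A ^ q) (n - 1 - i)))"
    using startsby_zero_power_prefix[OF A0]
    by (intro sum.cong refl arg_cong2[where f = times] sum.mono_neutral_left) auto
  also have "\<dots> = (\<Sum>q = 0..n - 1. fps_nth residue_fps q * fps_nth (?U * ?A ^ q) (n - 1))"
    unfolding sum_distrib_left fps_mult_nth by (subst sum.swap) (simp add: mult_ac)
  also have "\<dots> = (\<Sum>q = 0..n - 1. fps_nth residue_fps q * ?c q)"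
    by (simp only: fps_expansion_eqI[OF chebyshev_U_Arcsin_has_fps_expansion])
  also have "\<dots> = (\<Sum>q | 1 \<le> q \<and> q < n \<and> even (q + n). fps_nth residue_fps q * ?c q)"
  proof (intro sum.mono_neutral_right ballI)
    fix q assume q: "q \<in> {0..n - 1} - {q. 1 \<le> q \<and> q < n \<and> even (q + n)}"
    show "fps_nth residue_fps q * ?c q = 0"
    proof (cases "q = 0")
      case False
      with q assms have "odd (2 * k - 1 + q + (n - 1))" by auto
      from fps_expansion_chebyshev_U_Arcsin_eq_0[OF this] show ?thesis by (simp only: mult_zero_right)
    qed (simp add: residue_fps_def)
  qed (use assms in auto)
  also have "\<dots> = (\<Sum>q | 1 \<le> q \<and> q < n \<and> even (q + n). of_real (residue_sum q) * ?c q)"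
    by (intro sum.cong refl) (auto simp: residue_fps_def)
  finally show ?thesis
    using has_integral_sinh_over_cosh_power[OF assms] by simp
qed

theorem proposition2p2:
  fixes k m :: nat
  assumes "k \<ge> 1" and "m \<ge> 1"
  shows
    "(m > k \<longrightarrow>
       ((\<lambda>x::real. complex_of_real (sinh (2 * real k * x) / (x * cosh x ^ (2 * m)))) has_integral
         (\<Sum>p = 1..m - 1. (2 ^ (2 * p + 1) - 1) *
            (riemann_zeta (of_nat (2 * p + 1)) / complex_of_real pi ^ (2 * p)) *
            fps_nth (fps_expansion
              (\<lambda>z. poly (chebyshev_U (2 * k - 1)) z * Arcsin z ^ (2 * p)) 0) (2 * m - 1)))
         {0<..}) \<and>
     (m \<ge> k \<longrightarrow>
       ((\<lambda>x::real. complex_of_real (sinh (2 * real k * x) / (x * cosh x ^ (2 * m + 1)))) has_integral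
         (\<Sum>p = 1..m. 2 ^ (2 * p) *
            (dirichlet_beta (of_nat (2 * p)) / complex_of_real pi ^ (2 * p - 1)) *
            fps_nth (fps_expansion
              (\<lambda>z. poly (chebyshev_U (2 * k - 1)) z * Arcsin z ^ (2 * p - 1)) 0) (2 * m)))
         {0<..})"
proof (intro conjI impI)
  let ?c = "\<lambda>n q. fps_nth (fps_expansion (\<lambda>z. poly (chebyshev_U (2 * k - 1)) z * Arcsin z ^ q) 0) n"
  {
    assume "m > k"
    \<comment> \<open>The surviving indices are \<open>q = 2 * p\<close>, and
      \<open>q < 2 * m\<close> becomes \<open>p \<le> m - 1\<close>.\<close>
    have "(\<Sum>p = 1..m - 1. (2 ^ (2 * p + 1) - 1) *
            (riemann_zeta (of_nat (2 * p + 1)) / complex_of_real pi ^ (2 * p)) * ?c (2 * m - 1) (2 * p)) =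
       (\<Sum>q | 1 \<le> q \<and> q < 2 * m \<and> even (q + 2 * m). of_real (residue_sum q) * ?c (2 * m - 1) q)"
      by (intro sum.reindex_bij_witness[of _ "\<lambda>q. q div 2" "\<lambda>p. 2 * p"])
         (auto simp: residue_sum_even)
    with has_integral_sinh_over_cosh_power_residue_sum[OF assms(1), of "2 * m"] \<open>m > k\<close>
    show "((\<lambda>x::real. complex_of_real (sinh (2 * real k * x) / (x * cosh x ^ (2 * m)))) has_integral
         (\<Sum>p = 1..m - 1. (2 ^ (2 * p + 1) - 1) *
            (riemann_zeta (of_nat (2 * p + 1)) / complex_of_real pi ^ (2 * p)) * ?c (2 * m - 1) (2 * p)))
         {0<..}"
      by simp
  next
    assume "m \<ge> k"
    \<comment> \<open>Here the surviving indices are \<open>q = 2 * p - 1\<close>, and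
      \<open>q < 2 * m + 1\<close> becomes \<open>p \<le> m\<close>; the case \<open>m = k\<close>
      is covered since \<open>2 * m + 1 > 2 * k\<close>.\<close>
    have "(\<Sum>p = 1..m. 2 ^ (2 * p) *
            (dirichlet_beta (of_nat (2 * p)) / complex_of_real pi ^ (2 * p - 1)) * ?c (2 * m) (2 * p - 1)) =
       (\<Sum>q | 1 \<le> q \<and> q < 2 * m + 1 \<and> even (q + (2 * m + 1)). of_real (residue_sum q) * ?c (2 * m) q)"
      by (intro sum.reindex_bij_witness[of _ "\<lambda>q. (q + 1) div 2" "\<lambda>p. 2 * p - 1"])
         (auto simp: residue_sum_odd[simplified] elim!: oddE)
    with has_integral_sinh_over_cosh_power_residue_sum[OF assms(1), of "2 * m + 1"] \<open>m \<ge> k\<close>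
    show "((\<lambda>x::real. complex_of_real (sinh (2 * real k * x) / (x * cosh x ^ (2 * m + 1)))) has_integral
         (\<Sum>p = 1..m. 2 ^ (2 * p) *
            (dirichlet_beta (of_nat (2 * p)) / complex_of_real pi ^ (2 * p - 1)) * ?c (2 * m) (2 * p - 1)))
         {0<..}"
      by simp
  }
qed

end
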